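(* Let $\tau\in\{1,-1\}$ and let $\alpha(x_1,x_2)$ be a solution of the elliptic sinh-Gordon equation $$\alpha_{x_1x_1}+\alpha_{x_2x_2}=\sinh\alpha .\qquad(\ast)$$ Let $\alpha'$ and $\alpha''$ be solutions of the elliptic sine-Gordon equation $u_{x_1x_1}+u_{x_2x_2}=\sin u$ associated to $\alpha$ by the $\phi_1$- (resp. $\phi_2$-) B\"acklund transformation $\mathcal{B}^{0}$ defined in the context. If $\phi_1\ne\phi_2$, then there exists a unique solution $\alpha^*$ of $(\ast)$ which is associated to $\alpha'$ and $\alpha''$ by the $\phi_2$- (resp. $\phi_1$-) B\"acklund transformation $\mathcal{B}^{1}$ defined in the context. Moreover, $\alpha^*$ is given algebraically by $$\tanh\frac{\alpha^*}{2}=\frac{P-Q\tanh\bigl(\frac{\alpha}{2}\bigr)}{Q-P\tanh\bigl(\frac{\alpha}{2}\bigr)},$$ where $$P=\tau(\sinh\phi_2-\sinh\phi_1)\sin\Bigl(\frac{\alpha''-\alpha'}{2}\Bigr),\qquad Q=(1+\sinh\phi_1\sinh\phi_2)\cos\Bigl(\frac{\alpha''-\alpha'}{2}\Bigr)-\cosh\phi_1\cosh\phi_2 .$$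
   Context: Subscripts $x_i$ denote partial derivatives. The constant $\tau$ is the same in all the transformations, and the parameters $\phi$ (in particular $\phi_1,\phi_2$) are constants in $[0,\infty)$. $\beta'$ is associated to $\beta$ by the $\phi$-B\"acklund transformation $\mathcal{B}^{0}$ if $$\beta'_{x_1}-\beta_{x_2}=\frac{2}{\cosh\phi}\sin\frac{\beta'}{2}\cosh\frac{\beta}{2}+\frac{2\tau\sinh\phi}{\cosh\phi}\cos\frac{\beta'}{2}\sinh\frac{\beta}{2},$$ $$\beta'_{x_2}+\beta_{x_1}=-\frac{2}{\cosh\phi}\cos\frac{\beta'}{2}\sinh\frac{\beta}{2}+\frac{2\tau\sinh\phi}{\cosh\phi}\sin\frac{\beta'}{2}\cosh\frac{\beta}{2}.$$ $\beta'$ is associated to $\beta$ by the $\phi$-B\"acklund transformation $\mathcal{B}^{1}$ if $$\beta'_{x_1}-\beta_{x_2}=\frac{2}{\cosh\phi}\sinh\frac{\beta'}{2}\cos\frac{\beta}{2}+\frac{2\tau\sinh\phi}{\cosh\phi}\cosh\frac{\beta'}{2}\sin\frac{\beta}{2},$$ $$\beta'_{x_2}+\beta_{x_1}=-\frac{2}{\cosh\phi}\cosh\frac{\beta'}{2}\sin\frac{\beta}{2}+\frac{2\tau\sinh\phi}{\cosh\phi}\sinh\frac{\beta'}{2}\cos\frac{\beta}{2}.$$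
   Formalization: On an open connected domain, cosh φ₁ cosh φ₂ cos((α''−α')/2) > 1+sinh φ₁ sinh φ₂ is assumed throughout (otherwise a real α* can fail to exist), and uniqueness is claimed only if α'+α'' is not everywhere an odd multiple of 2π (then α itself also qualifies). *)

theory Defs
  imports "HOL-Analysis.Analysis"
begin

text \<open>Functions of \<open>(x\<^sub>1, x\<^sub>2)\<close> are total functions on \<open>real \<times> real\<close>; only their restriction to
  an open set \<open>U\<close> matters.\<close>

definition pd1 :: "(real \<times> real \<Rightarrow> real) \<Rightarrow> real \<times> real \<Rightarrow> real" where
  "pd1 f x = deriv (\<lambda>t. f (t, snd x)) (fst x)"

definition pd2 :: "(real \<times> real \<Rightarrow> real) \<Rightarrow> real \<times> real \<Rightarrow> real" where
  "pd2 f x = deriv (\<lambda>t. f (fst x, t)) (snd x)"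

text \<open>The value of \<^const>\<open>deriv\<close> is arbitrary where the derivative does not exist; the
  differentiability conjunct ensures that the partial derivatives are meaningful on \<open>U\<close>.\<close>

definition C1_on :: "(real \<times> real) set \<Rightarrow> (real \<times> real \<Rightarrow> real) \<Rightarrow> bool" where
  "C1_on U f \<longleftrightarrow> (\<forall>x\<in>U. f differentiable (at x)) \<and>
     continuous_on U (pd1 f) \<and> continuous_on U (pd2 f)"

definition C2_on :: "(real \<times> real) set \<Rightarrow> (real \<times> real \<Rightarrow> real) \<Rightarrow> bool" where
  "C2_on U f \<longleftrightarrow> C1_on U f \<and> C1_on U (pd1 f) \<and> C1_on U (pd2 f)"

definition elliptic_sinh_gordon_on :: "(real \<times> real) set \<Rightarrow> (real \<times> real \<Rightarrow> real) \<Rightarrow> bool" where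
  "elliptic_sinh_gordon_on U f \<longleftrightarrow>
     C2_on U f \<and> (\<forall>x\<in>U. pd1 (pd1 f) x + pd2 (pd2 f) x = sinh (f x))"

definition elliptic_sine_gordon_on :: "(real \<times> real) set \<Rightarrow> (real \<times> real \<Rightarrow> real) \<Rightarrow> bool" where
  "elliptic_sine_gordon_on U f \<longleftrightarrow>
     C2_on U f \<and> (\<forall>x\<in>U. pd1 (pd1 f) x + pd2 (pd2 f) x = sin (f x))"

text \<open>\<open>baecklund0_on U \<tau> \<phi> \<beta> \<beta>'\<close>: on \<open>U\<close>, \<open>\<beta>'\<close> is associated to \<open>\<beta>\<close> by the \<open>\<phi>\<close>-transformation
  of type 0; likewise \<open>baecklund1_on\<close> for type 1.\<close>

definition baecklund0_on ::
  "(real \<times> real) set \<Rightarrow> real \<Rightarrow> real \<Rightarrow> (real \<times> real \<Rightarrow> real) \<Rightarrow> (real \<times> real \<Rightarrow> real) \<Rightarrow> bool" where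
  "baecklund0_on U \<tau> \<phi> \<beta> \<beta>' \<longleftrightarrow> (\<forall>x\<in>U.
     pd1 \<beta>' x - pd2 \<beta> x =
       2 / cosh \<phi> * sin (\<beta>' x / 2) * cosh (\<beta> x / 2)
       + 2 * \<tau> * sinh \<phi> / cosh \<phi> * cos (\<beta>' x / 2) * sinh (\<beta> x / 2) \<and>
     pd2 \<beta>' x + pd1 \<beta> x =
       - (2 / cosh \<phi>) * cos (\<beta>' x / 2) * sinh (\<beta> x / 2)
       + 2 * \<tau> * sinh \<phi> / cosh \<phi> * sin (\<beta>' x / 2) * cosh (\<beta> x / 2))"

definition baecklund1_on ::
  "(real \<times> real) set \<Rightarrow> real \<Rightarrow> real \<Rightarrow> (real \<times> real \<Rightarrow> real) \<Rightarrow> (real \<times> real \<Rightarrow> real) \<Rightarrow> bool" where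
  "baecklund1_on U \<tau> \<phi> \<beta> \<beta>' \<longleftrightarrow> (\<forall>x\<in>U.
     pd1 \<beta>' x - pd2 \<beta> x =
       2 / cosh \<phi> * sinh (\<beta>' x / 2) * cos (\<beta> x / 2)
       + 2 * \<tau> * sinh \<phi> / cosh \<phi> * cosh (\<beta>' x / 2) * sin (\<beta> x / 2) \<and>
     pd2 \<beta>' x + pd1 \<beta> x =
       - (2 / cosh \<phi>) * cosh (\<beta>' x / 2) * sin (\<beta> x / 2)
       + 2 * \<tau> * sinh \<phi> / cosh \<phi> * sinh (\<beta>' x / 2) * cos (\<beta> x / 2))"

text \<open>The parameters are interchanged: the transformation from \<open>\<alpha>'\<close> uses \<open>\<phi>\<^sub>2\<close>, the one from
  \<open>\<alpha>''\<close> uses \<open>\<phi>\<^sub>1\<close>.\<close>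

definition associated_to_both_on ::
  "(real \<times> real) set \<Rightarrow> real \<Rightarrow> real \<Rightarrow> real \<Rightarrow> (real \<times> real \<Rightarrow> real) \<Rightarrow> (real \<times> real \<Rightarrow> real)
    \<Rightarrow> (real \<times> real \<Rightarrow> real) \<Rightarrow> bool" where
  "associated_to_both_on U \<tau> \<phi>\<^sub>1 \<phi>\<^sub>2 \<alpha>' \<alpha>'' \<beta> \<longleftrightarrow>
     elliptic_sinh_gordon_on U \<beta> \<and>
     baecklund1_on U \<tau> \<phi>\<^sub>2 \<alpha>' \<beta> \<and> baecklund1_on U \<tau> \<phi>\<^sub>1 \<alpha>'' \<beta>"

definition superposition_P :: "real \<Rightarrow> real \<Rightarrow> real \<Rightarrow> real \<Rightarrow> real \<Rightarrow> real" where
  "superposition_P \<tau> \<phi>\<^sub>1 \<phi>\<^sub>2 a' a'' = \<tau> * (sinh \<phi>\<^sub>2 - sinh \<phi>\<^sub>1) * sin ((a'' - a') / 2)"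

definition superposition_Q :: "real \<Rightarrow> real \<Rightarrow> real \<Rightarrow> real \<Rightarrow> real" where
  "superposition_Q \<phi>\<^sub>1 \<phi>\<^sub>2 a' a'' =
     (1 + sinh \<phi>\<^sub>1 * sinh \<phi>\<^sub>2) * cos ((a'' - a') / 2) - cosh \<phi>\<^sub>1 * cosh \<phi>\<^sub>2"

text \<open>With \<open>g = cosh \<phi>\<^sub>1 cosh \<phi>\<^sub>2 cos ((a'' - a') / 2) - (1 + sinh \<phi>\<^sub>1 sinh \<phi>\<^sub>2)\<close> one has
  \<open>Q\<^sup>2 - P\<^sup>2 = g\<^sup>2\<close>. The superposition formula has no real value where \<open>g = 0\<close>. Solving
  the two type-1 systems (which is possible if \<open>sin ((a' + a'') / 2) \<noteq> 0\<close>) for \<open>S = sinh (\<beta> / 2)\<close> and \<open>K = cosh (\<beta> / 2)\<close> gives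
  \<open>K g = P sinh (\<alpha> / 2) - Q cosh (\<alpha> / 2)\<close>, whose right-hand side is positive, so that
  \<open>K > 0\<close> forces \<open>g > 0\<close>.\<close>

definition superposition_regular :: "real \<Rightarrow> real \<Rightarrow> real \<Rightarrow> real \<Rightarrow> bool" where
  "superposition_regular \<phi>\<^sub>1 \<phi>\<^sub>2 a' a'' \<longleftrightarrow>
     1 + sinh \<phi>\<^sub>1 * sinh \<phi>\<^sub>2 < cosh \<phi>\<^sub>1 * cosh \<phi>\<^sub>2 * cos ((a'' - a') / 2)"

text \<open>\<open>a' + a''\<close> is an odd multiple of \<open>2\<pi>\<close>. If this holds throughout \<open>U\<close> for \<open>a' = \<alpha>' x\<close>,
  \<open>a'' = \<alpha>'' x\<close>, then the seed \<open>\<alpha>\<close> itself is associated to both \<open>\<alpha>'\<close> and \<open>\<alpha>''\<close>, in general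
  in addition to the solution given by the superposition formula.\<close>

definition superposition_degenerate :: "real \<Rightarrow> real \<Rightarrow> bool" where
  "superposition_degenerate a' a'' \<longleftrightarrow> cos ((a' + a'') / 2) = -1"

end

theory Submission
  imports Defs
begin

text \<open>With \<open>d = (\<alpha>'' - \<alpha>') / 2\<close>, the superposition formula reads \<open>\<beta> = 2 artanh (P / Q) - \<alpha>\<close>, by the
  subtraction formula for \<open>tanh\<close>; the shift \<open>2 artanh (P / Q)\<close> depends on \<open>d\<close> only. It is well defined
  because \<open>Q\<^sup>2 - P\<^sup>2 = g\<^sup>2\<close> with \<open>g = cosh \<phi>\<^sub>1 cosh \<phi>\<^sub>2 cos d - (1 + sinh \<phi>\<^sub>1 sinh \<phi>\<^sub>2)\<close>, which
  regularity makes positive, and its derivative in \<open>d\<close> is \<open>- 2 \<tau> (sinh \<phi>\<^sub>2 - sinh \<phi>\<^sub>1) / g\<close>.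

  Existence. The derivatives of \<open>\<alpha>\<close> cancel in the difference of the two type-0 systems. The gradient
  of \<open>d\<close> is therefore an algebraic expression in the values of \<open>\<alpha>\<close>, \<open>\<alpha>'\<close>, \<open>\<alpha>''\<close>, and everything claimed
  about \<open>\<beta>\<close> reduces by the chain rule to identities at a single point: the type-1 systems to
  \<open>superposed_gradient\<close>, used a second time with the roles of \<open>\<alpha>'\<close> and \<open>\<alpha>''\<close> exchanged, and the
  sinh-Gordon equation to \<open>superposed_laplacian\<close>.

  Uniqueness. Subtracting one type-1 system from the other leaves two linear equations for
  \<open>sinh (\<beta> / 2)\<close> and \<open>cosh (\<beta> / 2)\<close>; together with \<open>cosh\<^sup>2 - sinh\<^sup>2 = 1\<close> and \<open>cosh > 0\<close> they determine
  \<open>\<beta>\<close> at each nondegenerate point (\<open>superposed_unique\<close>). If there is such a point, any two solutions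
  agree there. They then agree on all of the connected set \<open>U\<close>, because a single type-1 system prescribes the full gradient of \<open>\<beta>\<close> as a function
  of \<open>\<beta>\<close> (\<open>baecklund1_unique_continuation\<close>).\<close>

section \<open>Partial derivatives on open subsets of the plane\<close>

lemma has_derivative_pd:
  assumes "f differentiable (at x)"
  shows "(f has_derivative (\<lambda>h. pd1 f x * fst h + pd2 f x * snd h)) (at x)"
proof -
  obtain f' where f': "(f has_derivative f') (at x)"
    using assms by (auto simp: differentiable_def)
  then interpret bounded_linear f' by (rule has_derivative_bounded_linear)
  have "((\<lambda>t. (t, snd x)) has_derivative (\<lambda>t. (t, 0))) (at (fst x))"
    by (intro has_derivative_Pair has_derivative_ident has_derivative_const)
  from has_derivative_compose[OF this, of f f'] f'
  have "((\<lambda>t. f (t, snd x)) has_derivative (\<lambda>t. f' (t, 0))) (at (fst x))" by simp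
  moreover have "(\<lambda>t. f' (t, 0)) = (*) (f' (1, 0))"
  proof
    show "f' (t, 0) = f' (1, 0) * t" for t using scale[of t "(1, 0)"] by (simp add: mult.commute)
  qed
  ultimately have 1: "pd1 f x = f' (1, 0)"
    by (simp add: pd1_def has_field_derivative_def DERIV_imp_deriv)
  have "((\<lambda>t. (fst x, t)) has_derivative (\<lambda>t. (0, t))) (at (snd x))"
    by (intro has_derivative_Pair has_derivative_ident has_derivative_const)
  from has_derivative_compose[OF this, of f f'] f'
  have "((\<lambda>t. f (fst x, t)) has_derivative (\<lambda>t. f' (0, t))) (at (snd x))" by simp
  moreover have "(\<lambda>t. f' (0, t)) = (*) (f' (0, 1))"
  proof
    show "f' (0, t) = f' (0, 1) * t" for t using scale[of t "(0, 1)"] by (simp add: mult.commute)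
  qed
  ultimately have 2: "pd2 f x = f' (0, 1)"
    by (simp add: pd2_def has_field_derivative_def DERIV_imp_deriv)
  have "f' h = pd1 f x * fst h + pd2 f x * snd h" for h
    using add[of "(fst h, 0)" "(0, snd h)"] scale[of "fst h" "(1, 0)"] scale[of "snd h" "(0, 1)"]
    by (simp add: 1 2 mult.commute)
  then have "f' = (\<lambda>h. pd1 f x * fst h + pd2 f x * snd h)" ..
  with f' show ?thesis by simp
qed

text \<open>Conversely, a total derivative gives the values of \<open>pd1\<close> and \<open>pd2\<close>; so all rules for partial
  derivatives below come from the rules for \<open>has_derivative\<close>.\<close>

lemma pd_eqI:
  assumes "(f has_derivative (\<lambda>h. a * fst h + b * snd h)) (at x)"
  shows "pd1 f x = a" "pd2 f x = b"
proof -
  have f: "f differentiable (at x)" using assms by (auto simp: differentiable_def)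
  have "(\<lambda>h. pd1 f x * fst h + pd2 f x * snd h) = (\<lambda>h. a * fst h + b * snd h)"
    by (rule has_derivative_unique[OF has_derivative_pd[OF f] assms])
  from fun_cong[OF this, of "(1, 0)"] fun_cong[OF this, of "(0, 1)"]
  show "pd1 f x = a" "pd2 f x = b" by simp_all
qed

lemma C1_on_has_derivative:
  "C1_on U f \<Longrightarrow> x \<in> U \<Longrightarrow> (f has_derivative (\<lambda>h. pd1 f x * fst h + pd2 f x * snd h)) (at x)"
  by (simp add: C1_on_def has_derivative_pd)

lemma C1_on_continuous_on: "C1_on U f \<Longrightarrow> continuous_on U f"
  by (simp add: C1_on_def continuous_at_imp_continuous_on differentiable_imp_continuous_within)

lemma C1_onI:
  assumes "\<And>x. x \<in> U \<Longrightarrow> (f has_derivative (\<lambda>h. f1 x * fst h + f2 x * snd h)) (at x)"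
    and "continuous_on U f1" "continuous_on U f2"
  shows "C1_on U f"
proof -
  have "continuous_on U (pd1 f)"
    using assms(2) by (rule continuous_on_eq) (simp add: pd_eqI(1)[OF assms(1)])
  moreover have "continuous_on U (pd2 f)"
    using assms(3) by (rule continuous_on_eq) (simp add: pd_eqI(2)[OF assms(1)])
  ultimately show ?thesis
    using assms(1) by (auto simp only: C1_on_def differentiable_def)
qed

text \<open>Second partial derivatives involve the values of \<open>pd1 f\<close> near a point; this lemma allows a
  formula for \<open>pd1 f\<close> that is valid on the open set \<open>U\<close> to be differentiated again.\<close>

lemma C1_on_cong:
  assumes "open U" "C1_on U f" "\<And>x. x \<in> U \<Longrightarrow> f x = g x"
  shows "C1_on U g"
    and "\<And>x. x \<in> U \<Longrightarrow> pd1 g x = pd1 f x" "\<And>x. x \<in> U \<Longrightarrow> pd2 g x = pd2 f x"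
proof -
  have g: "(g has_derivative (\<lambda>h. pd1 f x * fst h + pd2 f x * snd h)) (at x)" if "x \<in> U" for x
    using has_derivative_transform_within_open[OF C1_on_has_derivative[OF assms(2) that] assms(1) that]
      assms(3) by blast
  show "C1_on U g" using g assms(2) by (intro C1_onI[of U g "pd1 f" "pd2 f"]) (auto simp: C1_on_def)
  show "\<And>x. x \<in> U \<Longrightarrow> pd1 g x = pd1 f x" "\<And>x. x \<in> U \<Longrightarrow> pd2 g x = pd2 f x"
    using g by (auto intro: pd_eqI)
qed

lemma C1_on_linear_combination:
  assumes "C1_on U f" "C1_on U g"
  shows "C1_on U (\<lambda>x. a * f x + b * g x)"
    and "\<And>x. x \<in> U \<Longrightarrow> pd1 (\<lambda>x. a * f x + b * g x) x = a * pd1 f x + b * pd1 g x"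
    and "\<And>x. x \<in> U \<Longrightarrow> pd2 (\<lambda>x. a * f x + b * g x) x = a * pd2 f x + b * pd2 g x"
proof -
  have d: "((\<lambda>x. a * f x + b * g x) has_derivative
      (\<lambda>h. (a * pd1 f x + b * pd1 g x) * fst h + (a * pd2 f x + b * pd2 g x) * snd h)) (at x)"
    if "x \<in> U" for x
    using C1_on_has_derivative[OF assms(1) that] C1_on_has_derivative[OF assms(2) that]
    by (auto intro!: derivative_eq_intros simp: algebra_simps)
  then show "C1_on U (\<lambda>x. a * f x + b * g x)"
    using assms by (intro C1_onI[OF d]) (auto simp: C1_on_def intro!: continuous_intros)
  show "\<And>x. x \<in> U \<Longrightarrow> pd1 (\<lambda>x. a * f x + b * g x) x = a * pd1 f x + b * pd1 g x"
    "\<And>x. x \<in> U \<Longrightarrow> pd2 (\<lambda>x. a * f x + b * g x) x = a * pd2 f x + b * pd2 g x"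
    using pd_eqI[OF d] by blast+
qed

lemma C1_on_mult:
  assumes "C1_on U f" "C1_on U g"
  shows "C1_on U (\<lambda>x. f x * g x)"
    and "\<And>x. x \<in> U \<Longrightarrow> pd1 (\<lambda>x. f x * g x) x = pd1 f x * g x + f x * pd1 g x"
    and "\<And>x. x \<in> U \<Longrightarrow> pd2 (\<lambda>x. f x * g x) x = pd2 f x * g x + f x * pd2 g x"
proof -
  have d: "((\<lambda>x. f x * g x) has_derivative
      (\<lambda>h. (pd1 f x * g x + f x * pd1 g x) * fst h + (pd2 f x * g x + f x * pd2 g x) * snd h)) (at x)"
    if "x \<in> U" for x
    using C1_on_has_derivative[OF assms(1) that] C1_on_has_derivative[OF assms(2) that]
    by (auto intro!: derivative_eq_intros simp: algebra_simps)
  then show "C1_on U (\<lambda>x. f x * g x)"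
    using assms C1_on_continuous_on[of U f] C1_on_continuous_on[of U g]
    by (intro C1_onI[OF d]) (auto simp: C1_on_def intro!: continuous_intros)
  show "\<And>x. x \<in> U \<Longrightarrow> pd1 (\<lambda>x. f x * g x) x = pd1 f x * g x + f x * pd1 g x"
    "\<And>x. x \<in> U \<Longrightarrow> pd2 (\<lambda>x. f x * g x) x = pd2 f x * g x + f x * pd2 g x"
    using pd_eqI[OF d] by blast+
qed

lemma C1_on_compose:
  assumes "C1_on U f"
    and "\<And>x. x \<in> U \<Longrightarrow> (h has_field_derivative h' (f x)) (at (f x))"
    and "continuous_on U (\<lambda>x. h' (f x))"
  shows "C1_on U (\<lambda>x. h (f x))"
    and "\<And>x. x \<in> U \<Longrightarrow> pd1 (\<lambda>x. h (f x)) x = h' (f x) * pd1 f x"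
    and "\<And>x. x \<in> U \<Longrightarrow> pd2 (\<lambda>x. h (f x)) x = h' (f x) * pd2 f x"
proof -
  have d: "((\<lambda>x. h (f x)) has_derivative
      (\<lambda>v. (h' (f x) * pd1 f x) * fst v + (h' (f x) * pd2 f x) * snd v)) (at x)"
    if "x \<in> U" for x
    using has_derivative_compose[OF C1_on_has_derivative[OF assms(1) that]
        assms(2)[OF that, unfolded has_field_derivative_def]]
    by (simp add: algebra_simps)
  then show "C1_on U (\<lambda>x. h (f x))"
    using assms by (intro C1_onI[OF d]) (auto simp: C1_on_def intro!: continuous_intros)
  show "\<And>x. x \<in> U \<Longrightarrow> pd1 (\<lambda>x. h (f x)) x = h' (f x) * pd1 f x"
    "\<And>x. x \<in> U \<Longrightarrow> pd2 (\<lambda>x. h (f x)) x = h' (f x) * pd2 f x"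
    using pd_eqI[OF d] by blast+
qed

lemma C2_on_linear_combination:
  assumes "open U" "C2_on U f" "C2_on U g"
  shows "C2_on U (\<lambda>x. a * f x + b * g x)"
    and "\<And>x. x \<in> U \<Longrightarrow> pd1 (pd1 (\<lambda>x. a * f x + b * g x)) x + pd2 (pd2 (\<lambda>x. a * f x + b * g x)) x
      = a * (pd1 (pd1 f) x + pd2 (pd2 f) x) + b * (pd1 (pd1 g) x + pd2 (pd2 g) x)"
proof -
  let ?k = "\<lambda>x. a * f x + b * g x"
  have C1: "C1_on U f" "C1_on U g" "C1_on U (pd1 f)" "C1_on U (pd1 g)" "C1_on U (pd2 f)" "C1_on U (pd2 g)"
    using assms by (auto simp: C2_on_def)
  note k = C1_on_linear_combination[OF C1(1,2), where a = a and b = b]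
  note k1 = C1_on_linear_combination[OF C1(3,4), where a = a and b = b]
  note k2 = C1_on_linear_combination[OF C1(5,6), where a = a and b = b]
  note 1 = C1_on_cong[OF assms(1) k1(1) k(2)[symmetric]]
  note 2 = C1_on_cong[OF assms(1) k2(1) k(3)[symmetric]]
  show "C2_on U ?k" using k 1 2 by (simp add: C2_on_def)
  show "pd1 (pd1 ?k) x + pd2 (pd2 ?k) x
      = a * (pd1 (pd1 f) x + pd2 (pd2 f) x) + b * (pd1 (pd1 g) x + pd2 (pd2 g) x)" if "x \<in> U" for x
    using that 1(2) 2(3) k1(2) k2(3) by (simp add: algebra_simps)
qed

lemma C2_on_compose:
  assumes "open U" "C2_on U f"
    and h: "\<And>x. x \<in> U \<Longrightarrow> (h has_field_derivative h' (f x)) (at (f x))"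
    and h': "\<And>x. x \<in> U \<Longrightarrow> (h' has_field_derivative h'' (f x)) (at (f x))"
    and cont: "continuous_on U (\<lambda>x. h'' (f x))"
  shows "C2_on U (\<lambda>x. h (f x))"
    and "\<And>x. x \<in> U \<Longrightarrow> pd1 (pd1 (\<lambda>x. h (f x))) x + pd2 (pd2 (\<lambda>x. h (f x))) x
      = h'' (f x) * ((pd1 f x)\<^sup>2 + (pd2 f x)\<^sup>2) + h' (f x) * (pd1 (pd1 f) x + pd2 (pd2 f) x)"
proof -
  let ?k = "\<lambda>x. h (f x)"
  have C1: "C1_on U f" "C1_on U (pd1 f)" "C1_on U (pd2 f)"
    using assms by (auto simp: C2_on_def)
  note h'_f = C1_on_compose[OF C1(1) h' cont]
  note k = C1_on_compose[OF C1(1) h C1_on_continuous_on[OF h'_f(1)]]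
  note k1 = C1_on_mult[OF h'_f(1) C1(2)]
  note k2 = C1_on_mult[OF h'_f(1) C1(3)]
  note 1 = C1_on_cong[OF assms(1) k1(1) k(2)[symmetric]]
  note 2 = C1_on_cong[OF assms(1) k2(1) k(3)[symmetric]]
  show "C2_on U ?k" using k 1 2 by (simp add: C2_on_def)
  show "pd1 (pd1 ?k) x + pd2 (pd2 ?k) x
      = h'' (f x) * ((pd1 f x)\<^sup>2 + (pd2 f x)\<^sup>2) + h' (f x) * (pd1 (pd1 f) x + pd2 (pd2 f) x)"
    if "x \<in> U" for x
    using that 1(2) 2(3) k1(2) k2(3) h'_f(2,3) by (simp add: algebra_simps power2_eq_square)
qed

text \<open>Along a straight segment, \<open>z\<close> satisfies the linear equation \<open>w' = \<kappa> w\<close> with continuous \<open>\<kappa>\<close>, so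
  multiplying it by the integrating factor \<open>exp (- \<integral> \<kappa>)\<close> gives a constant. Hence the zero set of
  \<open>z\<close> is open as well as closed in \<open>U\<close>.\<close>

lemma zero_on_connected_of_log_gradient:
  fixes z k1 k2 :: "real \<times> real \<Rightarrow> real"
  assumes "open U" "connected U"
    and z: "C1_on U z"
    and k: "continuous_on U k1" "continuous_on U k2"
    and z1: "\<And>x. x \<in> U \<Longrightarrow> pd1 z x = k1 x * z x"
    and z2: "\<And>x. x \<in> U \<Longrightarrow> pd2 z x = k2 x * z x"
    and "x0 \<in> U" "z x0 = 0" "x \<in> U"
  shows "z x = 0"
proof -
  have local: "z y = 0" if y0: "ball y0 e \<subseteq> U" "z y0 = 0" "y \<in> ball y0 e" for y0 y e
  proof -
    define c where "c t = y0 + t *\<^sub>R (y - y0)" for t :: real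
    have c: "c t \<in> ball y0 e" if "t \<in> {0..1}" for t
      using that y0(3) mult_left_le_one_le[of "norm (y - y0)" t]
      by (simp add: c_def dist_norm norm_minus_commute)
    then have cU: "c t \<in> U" if "t \<in> {0..1}" for t using y0 that by blast
    define \<kappa> where "\<kappa> t = k1 (c t) * fst (y - y0) + k2 (c t) * snd (y - y0)" for t
    have contc: "continuous_on {0..1} c" unfolding c_def by (intro continuous_intros)
    have "continuous_on {0..1} \<kappa>"
      unfolding \<kappa>_def using cU
      by (intro continuous_intros continuous_on_compose2[OF k(1) contc]
          continuous_on_compose2[OF k(2) contc]) auto
    then obtain G where G: "\<And>t. t \<in> {0..1} \<Longrightarrow> (G has_vector_derivative \<kappa> t) (at t within {0..1})"
      using antiderivative_continuous by blast
    define w where "w t = z (c t) * exp (- G t)" for t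
    have "(w has_derivative (\<lambda>h. 0)) (at t within {0..1})" if t: "t \<in> {0..1}" for t
    proof -
      have "(c has_derivative (\<lambda>h. h *\<^sub>R (y - y0))) (at t within {0..1})"
        unfolding c_def by (auto intro!: derivative_eq_intros)
      from has_derivative_compose[OF this C1_on_has_derivative[OF z cU[OF t]]]
      have "((\<lambda>t. z (c t)) has_field_derivative \<kappa> t * z (c t)) (at t within {0..1})"
        unfolding has_field_derivative_def
        by (rule has_derivative_eq_rhs) (use cU[OF t] in \<open>auto simp: \<kappa>_def z1 z2 algebra_simps\<close>)
      moreover have "(G has_field_derivative \<kappa> t) (at t within {0..1})"
        using G[OF t] by (simp add: has_real_derivative_iff_has_vector_derivative)
      ultimately have "(w has_field_derivative 0) (at t within {0..1})"
        unfolding w_def by (auto intro!: derivative_eq_intros)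
      then show ?thesis by (simp add: has_field_derivative_def lambda_zero)
    qed
    then obtain C where "\<And>t. t \<in> {0..1} \<Longrightarrow> w t = C"
      using has_derivative_zero_constant[of "{0..1::real}" w] by auto
    then have "w 1 = w 0" by simp
    then show ?thesis using y0(2) by (simp add: w_def c_def)
  qed
  have openZ: "open {y \<in> U. z y = 0}"
    unfolding open_contains_ball
  proof
    fix y assume y: "y \<in> {y \<in> U. z y = 0}"
    then obtain e where "e > 0" "ball y e \<subseteq> U" using assms(1) open_contains_ball by blast
    then show "\<exists>e>0. ball y e \<subseteq> {y \<in> U. z y = 0}" using local[of y e] y by blast
  qed
  have "open (U \<inter> z -` (- {0}))"
    using continuous_open_preimage[OF C1_on_continuous_on[OF z] assms(1)] by blast
  moreover have "U \<inter> z -` (- {0}) = {y \<in> U. z y \<noteq> 0}" by auto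
  ultimately have openN: "open {y \<in> U. z y \<noteq> 0}" by simp
  show ?thesis
    using connectedD[OF assms(2) openZ openN] assms(8-10) by blast
qed

section \<open>The algebra of the superposition formula\<close>

lemma tanh_artanh_real:
  fixes x :: real
  assumes "\<bar>x\<bar> < 1" shows "tanh (artanh x) = x"
proof -
  have e: "exp (- 2 * artanh x) = (1 - x) / (1 + x)"
    using assms by (simp add: artanh_def exp_minus abs_less_iff)
  then show ?thesis
    unfolding tanh_real_altdef e using assms by (simp add: field_simps abs_less_iff)
qed

text \<open>The superposition formula and the right-hand sides of the systems involve only the values of the
  functions at a single point. Writing \<open>\<sigma> = \<tau> sinh \<phi>\<close> and \<open>c = cosh \<phi>\<close> absorbs the sign
  \<open>\<tau>\<close>: since \<open>\<tau>\<^sup>2 = 1\<close>, one still has \<open>c\<^sup>2 = 1 + \<sigma>\<^sup>2\<close>, and \<open>sinh \<phi>\<^sub>1 sinh \<phi>\<^sub>2 = \<sigma>\<^sub>1 \<sigma>\<^sub>2\<close>. In this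
  form the two parameters play symmetric roles, and the locale can be instantiated a second time
  with the indices exchanged.\<close>

locale superposition =
  fixes c1 \<sigma>1 c2 \<sigma>2 :: real
  assumes c1_pos: "0 < c1" and c2_pos: "0 < c2"
    and c1_sq: "c1\<^sup>2 = 1 + \<sigma>1\<^sup>2" and c2_sq: "c2\<^sup>2 = 1 + \<sigma>2\<^sup>2"
begin

definition P :: "real \<Rightarrow> real" where "P d = (\<sigma>2 - \<sigma>1) * sin d"
definition Q :: "real \<Rightarrow> real" where "Q d = (1 + \<sigma>1 * \<sigma>2) * cos d - c1 * c2"
definition g :: "real \<Rightarrow> real" where "g d = c1 * c2 * cos d - (1 + \<sigma>1 * \<sigma>2)"

text \<open>The quotient \<open>(P - Q tanh a) / (Q - P tanh a)\<close> is the subtraction formula for \<open>tanh\<close>, applied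
  to \<open>artanh (P / Q)\<close> and \<open>a\<close>. So the superposed solution is \<open>shift d - \<alpha>\<close>, where
  \<open>d = (\<alpha>'' - \<alpha>') / 2\<close>: a function of \<open>d\<close> alone minus the seed.\<close>

definition shift :: "real \<Rightarrow> real" where "shift d = 2 * artanh (P d / Q d)"

lemma c1_c2_sq: "(c1 * c2)\<^sup>2 = (1 + \<sigma>1 * \<sigma>2)\<^sup>2 + (\<sigma>2 - \<sigma>1)\<^sup>2"
  using c1_sq c2_sq by algebra

lemma abs_le_c1_c2: "\<bar>1 + \<sigma>1 * \<sigma>2\<bar> \<le> c1 * c2"
proof -
  have "(1 + \<sigma>1 * \<sigma>2)\<^sup>2 \<le> (c1 * c2)\<^sup>2" unfolding c1_c2_sq by simp
  then have "\<bar>1 + \<sigma>1 * \<sigma>2\<bar> \<le> \<bar>c1 * c2\<bar>" by (simp only: abs_le_square_iff)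
  then show ?thesis using c1_pos c2_pos by simp
qed

lemma Q_sq_minus_P_sq: "(Q d)\<^sup>2 - (P d)\<^sup>2 = (g d)\<^sup>2"
  using c1_c2_sq sin_cos_squared_add[of d] unfolding P_def Q_def g_def by algebra

lemma Q_neg:
  assumes "g d > 0" shows "Q d < 0"
proof -
  have "(1 + \<sigma>1 * \<sigma>2) * cos d \<le> \<bar>1 + \<sigma>1 * \<sigma>2\<bar>"
    using abs_le_D1[of "(1 + \<sigma>1 * \<sigma>2) * cos d"] mult_left_le[of "\<bar>cos d\<bar>" "\<bar>1 + \<sigma>1 * \<sigma>2\<bar>"]
    by (simp add: abs_mult)
  then have "Q d \<le> 0" using abs_le_c1_c2 by (simp add: Q_def)
  moreover have "Q d \<noteq> 0"
  proof
    assume "Q d = 0"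
    then have "- (P d)\<^sup>2 = (g d)\<^sup>2" using Q_sq_minus_P_sq[of d] by simp
    then show False
      using zero_le_power2[of "P d"] zero_less_power[OF assms, of 2] by linarith
  qed
  ultimately show ?thesis by simp
qed

lemma abs_P_div_Q_less_1:
  assumes "g d > 0" shows "\<bar>P d / Q d\<bar> < 1"
proof -
  have "(P d)\<^sup>2 < (Q d)\<^sup>2" using Q_sq_minus_P_sq[of d] zero_less_power[OF assms, of 2] by linarith
  then have "\<bar>P d\<bar> < \<bar>Q d\<bar>" by (simp add: abs_le_square_iff flip: not_le)
  then show ?thesis using Q_neg[OF assms] by (simp add: abs_divide neg_less_divide_eq)
qed

lemma tanh_half_shift: "g d > 0 \<Longrightarrow> tanh (shift d / 2) = P d / Q d"
  using abs_P_div_Q_less_1 by (simp add: shift_def tanh_artanh_real)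

text \<open>The sign is forced: \<open>Q\<^sup>2 - P\<^sup>2 = g\<^sup>2\<close> fixes \<open>cosh\<close> up to sign, and \<open>Q\<close> is negative where \<open>g\<close> is
  positive.\<close>

lemma cosh_sinh_half_shift:
  assumes "g d > 0"
  shows "cosh (shift d / 2) = - Q d / g d" "sinh (shift d / 2) = - P d / g d"
proof -
  have Q: "Q d < 0" by (rule Q_neg[OF assms])
  let ?C = "cosh (shift d / 2)" and ?S = "sinh (shift d / 2)"
  have S: "?S * Q d = P d * ?C"
    using tanh_half_shift[OF assms] Q by (simp add: tanh_def field_simps)
  have "(?C * g d)\<^sup>2 = ?C\<^sup>2 * ((Q d)\<^sup>2 - (P d)\<^sup>2)"
    by (simp add: power_mult_distrib Q_sq_minus_P_sq)
  also have "\<dots> = (?C * Q d)\<^sup>2 - (P d * ?C)\<^sup>2" by (simp add: algebra_simps power_mult_distrib)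
  also have "\<dots> = (?C\<^sup>2 - ?S\<^sup>2) * (Q d)\<^sup>2" unfolding S[symmetric] by (simp add: algebra_simps power_mult_distrib)
  also have "\<dots> = (- Q d)\<^sup>2" by (simp add: cosh_square_eq)
  finally have "?C * g d = - Q d"
    using Q assms by (intro power2_eq_imp_eq[of "?C * g d"]) auto
  then show C: "?C = - Q d / g d" using assms by (simp add: field_simps)
  from S have "?S = P d * ?C / Q d" using Q by (simp add: field_simps)
  then show "?S = - P d / g d" using Q by (simp add: C)
qed

text \<open>The numerator of the derivative of \<open>P / Q\<close> is a constant times \<open>g\<close>, and \<open>1 - (P / Q)\<^sup>2\<close> is
  \<open>g\<^sup>2 / Q\<^sup>2\<close>; hence only one power of \<open>g\<close> survives in the denominator.\<close>

lemma shift_has_field_derivative: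
  assumes "g d > 0"
  shows "(shift has_field_derivative - 2 * (\<sigma>2 - \<sigma>1) / g d) (at d)"
proof -
  have Q: "Q d \<noteq> 0" using Q_neg[OF assms] by simp
  have PQ: "((\<lambda>d. P d / Q d) has_field_derivative - (\<sigma>2 - \<sigma>1) * g d / (Q d)\<^sup>2) (at d)"
    (is "(_ has_field_derivative ?r) _")
  proof -
    have "((\<lambda>d. P d / Q d) has_field_derivative
        ((\<sigma>2 - \<sigma>1) * cos d * Q d - P d * (- (1 + \<sigma>1 * \<sigma>2) * sin d)) / (Q d * Q d)) (at d)"
      using Q unfolding P_def Q_def by (auto intro!: derivative_eq_intros simp: algebra_simps)
    moreover have "(\<sigma>2 - \<sigma>1) * cos d * Q d - P d * (- (1 + \<sigma>1 * \<sigma>2) * sin d) = - (\<sigma>2 - \<sigma>1) * g d"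
      using sin_cos_squared_add[of d] unfolding P_def Q_def g_def by algebra
    ultimately show ?thesis by (simp add: power2_eq_square)
  qed
  have "(shift has_field_derivative 2 * (1 / (1 - (P d / Q d)\<^sup>2) * ?r)) (at d)"
    unfolding shift_def
    by (intro DERIV_cmult DERIV_chain2[OF artanh_real_has_field_derivative PQ]
        abs_P_div_Q_less_1 assms)
  moreover have "1 - (P d / Q d)\<^sup>2 = (g d)\<^sup>2 / (Q d)\<^sup>2"
    unfolding Q_sq_minus_P_sq[symmetric] using Q by (simp add: diff_divide_distrib power_divide)
  ultimately show ?thesis using Q assms by (simp add: power2_eq_square)
qed

lemma shift_derivative_has_field_derivative:
  assumes "g d > 0"
  shows "((\<lambda>d. - 2 * (\<sigma>2 - \<sigma>1) / g d) has_field_derivative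
    - 2 * (\<sigma>2 - \<sigma>1) * (c1 * c2) * sin d / (g d)\<^sup>2) (at d)"
  using assms unfolding g_def
  by (auto intro!: derivative_eq_intros simp: power2_eq_square)

lemma cosh_sinh_superposed:
  assumes "g d > 0"
  shows "g d * sinh (shift d / 2 - a) = Q d * sinh a - P d * cosh a"
    and "g d * cosh (shift d / 2 - a) = P d * sinh a - Q d * cosh a"
  using assms by (simp_all add: sinh_diff cosh_diff cosh_sinh_half_shift algebra_simps)

lemma tanh_superposed:
  assumes "g d > 0"
  shows "tanh (shift d / 2 - a) = (P d - Q d * tanh a) / (Q d - P d * tanh a)"
proof -
  have "tanh (shift d / 2 - a) = (g d * sinh (shift d / 2 - a)) / (g d * cosh (shift d / 2 - a))"
    using assms by (simp add: tanh_def)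
  also have "\<dots> = (Q d * sinh a - P d * cosh a) / (P d * sinh a - Q d * cosh a)"
    by (simp only: cosh_sinh_superposed[OF assms])
  also have "\<dots> = (Q d * tanh a - P d) * cosh a / ((P d * tanh a - Q d) * cosh a)"
    by (simp add: tanh_def left_diff_distrib)
  also have "\<dots> = (Q d * tanh a - P d) / (P d * tanh a - Q d)" by simp
  also have "\<dots> = (P d - Q d * tanh a) / (Q d - P d * tanh a)"
    by (subst minus_divide_divide[symmetric]) simp
  finally show ?thesis .
qed

text \<open>Here \<open>A\<close>, \<open>B\<close>, \<open>a\<close> stand for the values of \<open>\<alpha>' / 2\<close>, \<open>\<alpha>'' / 2\<close>, \<open>\<alpha> / 2\<close> at a point.
  In the difference of the two type-0 systems the derivatives of \<open>\<alpha>\<close> cancel, so the gradient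
  \<open>(e1, e2)\<close> of \<open>B - A\<close> is an explicit function of these values. The two equations below are then
  what the type-1 system from \<open>\<alpha>'\<close> says about \<open>shift (B - A) - \<alpha>\<close>. Multiplied by
  \<open>c1 * c2 * g\<close> they become linear in \<open>cosh a\<close> and \<open>sinh a\<close>, and the coefficients agree modulo
  \<open>c\<^sup>2 = 1 + \<sigma>\<^sup>2\<close> once \<open>B\<close> is expanded as \<open>A + d\<close>.\<close>

lemma superposed_gradient:
  fixes A B a :: real
  assumes "g (B - A) > 0"
  defines "b \<equiv> shift (B - A) / 2 - a"
    and "e1 \<equiv> (sin B * cosh a + \<sigma>2 * cos B * sinh a) / c2 - (sin A * cosh a + \<sigma>1 * cos A * sinh a) / c1"
    and "e2 \<equiv> (\<sigma>2 * sin B * cosh a - cos B * sinh a) / c2 - (\<sigma>1 * sin A * cosh a - cos A * sinh a) / c1"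
  shows "- 2 * (\<sigma>2 - \<sigma>1) / g (B - A) * e1 - 2 / c1 * (\<sigma>1 * sin A * cosh a - cos A * sinh a)
      = 2 / c2 * (sinh b * cos A + \<sigma>2 * cosh b * sin A)"
    and "- 2 * (\<sigma>2 - \<sigma>1) / g (B - A) * e2 + 2 / c1 * (sin A * cosh a + \<sigma>1 * cos A * sinh a)
      = 2 / c2 * (\<sigma>2 * sinh b * cos A - cosh b * sin A)"
proof -
  define d where "d = B - A"
  have g: "g d > 0" using assms by (simp add: d_def)
  have B: "sin B = sin A * cos d + cos A * sin d" "cos B = cos A * cos d - sin A * sin d"
    using sin_add[of A d] cos_add[of A d] by (simp_all add: d_def)
  note b = cosh_sinh_superposed[OF g, of a, folded b_def[folded d_def]]
  have e: "c1 * c2 * (u / c2 - v / c1) = c1 * u - c2 * v" for u v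
    using c1_pos c2_pos by (simp add: right_diff_distrib)
  have "- (\<sigma>2 - \<sigma>1) * (c1 * (sin B * cosh a + \<sigma>2 * cos B * sinh a) - c2 * (sin A * cosh a + \<sigma>1 * cos A * sinh a))
      - c2 * g d * (\<sigma>1 * sin A * cosh a - cos A * sinh a)
    = c1 * ((Q d * sinh a - P d * cosh a) * cos A + \<sigma>2 * (P d * sinh a - Q d * cosh a) * sin A)"
    using c1_sq c2_sq unfolding B P_def Q_def g_def by algebra
  then have "- (\<sigma>2 - \<sigma>1) * (c1 * c2 * e1) - c2 * g d * (\<sigma>1 * sin A * cosh a - cos A * sinh a)
    = c1 * g d * (sinh b * cos A + \<sigma>2 * cosh b * sin A)"
    unfolding e1_def e2_def e b[symmetric] by (simp add: algebra_simps)
  then show "- 2 * (\<sigma>2 - \<sigma>1) / g (B - A) * e1 - 2 / c1 * (\<sigma>1 * sin A * cosh a - cos A * sinh a)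
      = 2 / c2 * (sinh b * cos A + \<sigma>2 * cosh b * sin A)"
    using g c1_pos c2_pos unfolding d_def[symmetric] by (simp add: field_simps)
  have "- (\<sigma>2 - \<sigma>1) * (c1 * (\<sigma>2 * sin B * cosh a - cos B * sinh a) - c2 * (\<sigma>1 * sin A * cosh a - cos A * sinh a))
      + c2 * g d * (sin A * cosh a + \<sigma>1 * cos A * sinh a)
    = c1 * (\<sigma>2 * (Q d * sinh a - P d * cosh a) * cos A - (P d * sinh a - Q d * cosh a) * sin A)"
    using c1_sq c2_sq unfolding B P_def Q_def g_def by algebra
  then have "- (\<sigma>2 - \<sigma>1) * (c1 * c2 * e2) + c2 * g d * (sin A * cosh a + \<sigma>1 * cos A * sinh a)
    = c1 * g d * (\<sigma>2 * sinh b * cos A - cosh b * sin A)"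
    unfolding e1_def e2_def e b[symmetric] by (simp add: algebra_simps)
  then show "- 2 * (\<sigma>2 - \<sigma>1) / g (B - A) * e2 + 2 / c1 * (sin A * cosh a + \<sigma>1 * cos A * sinh a)
      = 2 / c2 * (\<sigma>2 * sinh b * cos A - cosh b * sin A)"
    using g c1_pos c2_pos unfolding d_def[symmetric] by (simp add: field_simps)
qed

text \<open>The left-hand side is the Laplacian of \<open>shift (B - A)\<close> by the chain rule, with \<open>(e1, e2)\<close> as
  above and the sine-Gordon equation inserted for the Laplacian of \<open>B - A\<close>; so the lemma is the
  sinh-Gordon equation for the superposed function. Using the explicit gradient in this way avoids
  differentiating the type-1 system and commuting mixed second derivatives of \<open>\<alpha>'\<close>.\<close>

lemma superposed_laplacian:
  fixes A B a :: real
  assumes "g (B - A) > 0"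
  defines "b \<equiv> shift (B - A) / 2 - a"
    and "e1 \<equiv> (sin B * cosh a + \<sigma>2 * cos B * sinh a) / c2 - (sin A * cosh a + \<sigma>1 * cos A * sinh a) / c1"
    and "e2 \<equiv> (\<sigma>2 * sin B * cosh a - cos B * sinh a) / c2 - (\<sigma>1 * sin A * cosh a - cos A * sinh a) / c1"
  shows "- 2 * (\<sigma>2 - \<sigma>1) * (c1 * c2) * sin (B - A) / (g (B - A))\<^sup>2 * (e1\<^sup>2 + e2\<^sup>2)
      + - 2 * (\<sigma>2 - \<sigma>1) / g (B - A) * ((sin (2 * B) - sin (2 * A)) / 2)
    = sinh (2 * a) + sinh (2 * b)"
proof -
  define d where "d = B - A"
  define C S where "C = cosh a" and "S = sinh a"
  have g: "g d > 0" using assms by (simp add: d_def)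
  note b = cosh_sinh_superposed[OF g, of a, folded b_def[folded d_def] C_def S_def]
  have CS: "C\<^sup>2 = 1 + S\<^sup>2" by (simp add: C_def S_def cosh_square_eq)
  have sA: "(sin A)\<^sup>2 + (cos A)\<^sup>2 = 1" and sB: "(sin B)\<^sup>2 + (cos B)\<^sup>2 = 1" by simp_all
  define s1 k1 s2 k2 where "s1 = sin A" and "k1 = cos A" and "s2 = sin B" and "k2 = cos B"
  note ang = s1_def[symmetric] k1_def[symmetric] s2_def[symmetric] k2_def[symmetric]
  note sA = sA[unfolded ang] and sB = sB[unfolded ang]
  have sd: "sin d = s2 * k1 - k2 * s1" and kd: "cos d = k2 * k1 + s2 * s1"
    by (simp_all add: d_def ang sin_diff cos_diff)
  let ?n = "c1 * c2"
  have e: "?n * e1 = c1 * (s2 * C + \<sigma>2 * k2 * S) - c2 * (s1 * C + \<sigma>1 * k1 * S)"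
    "?n * e2 = c1 * (\<sigma>2 * s2 * C - k2 * S) - c2 * (\<sigma>1 * s1 * C - k1 * S)"
    using c1_pos c2_pos by (simp_all add: e1_def e2_def ang C_def[symmetric] S_def[symmetric] field_simps)
  \<comment> \<open>The squared gradient has the denominator \<open>c1 * c2\<close> instead of its square: in the coefficients of
    \<open>C\<^sup>2\<close> and \<open>S\<^sup>2\<close> the factors \<open>1 + \<sigma>\<^sup>2 = c\<^sup>2\<close> arise and cancel, and in that of \<open>C * S\<close> only mixed
    terms survive.\<close>
  have "?n\<^sup>2 * (e1\<^sup>2 + e2\<^sup>2) = (?n * e1)\<^sup>2 + (?n * e2)\<^sup>2" by (simp add: algebra_simps power_mult_distrib)
  also have "\<dots> = ?n * (C\<^sup>2 * (?n * (s1\<^sup>2 + s2\<^sup>2) - 2 * (1 + \<sigma>1 * \<sigma>2) * s1 * s2)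
      + S\<^sup>2 * (?n * (k1\<^sup>2 + k2\<^sup>2) - 2 * (1 + \<sigma>1 * \<sigma>2) * k1 * k2)
      + 2 * C * S * P d)"
    unfolding e P_def sd using c1_sq c2_sq by algebra
  finally have "?n * (?n * (e1\<^sup>2 + e2\<^sup>2)) = ?n * (C\<^sup>2 * (?n * (s1\<^sup>2 + s2\<^sup>2) - 2 * (1 + \<sigma>1 * \<sigma>2) * s1 * s2)
      + S\<^sup>2 * (?n * (k1\<^sup>2 + k2\<^sup>2) - 2 * (1 + \<sigma>1 * \<sigma>2) * k1 * k2)
      + 2 * C * S * P d)" by (simp add: power2_eq_square algebra_simps)
  then have grad: "?n * (e1\<^sup>2 + e2\<^sup>2) = C\<^sup>2 * (?n * (s1\<^sup>2 + s2\<^sup>2) - 2 * (1 + \<sigma>1 * \<sigma>2) * s1 * s2)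
      + S\<^sup>2 * (?n * (k1\<^sup>2 + k2\<^sup>2) - 2 * (1 + \<sigma>1 * \<sigma>2) * k1 * k2)
      + 2 * C * S * P d" using c1_pos c2_pos by simp
  \<comment> \<open>\<open>k1 * k2 - s1 * s2\<close> is \<open>cos (A + B)\<close>.\<close>
  have grad': "?n * (e1\<^sup>2 + e2\<^sup>2) = 2 * P d * S * C - Q d * (C\<^sup>2 + S\<^sup>2) - g d * (k1 * k2 - s1 * s2)"
    unfolding grad Q_def g_def kd using sA sB CS by algebra
  have sin2: "(sin (2 * B) - sin (2 * A)) / 2 = (k1 * k2 - s1 * s2) * sin d"
    unfolding sin_double ang sd using sA sB by algebra
  have "(g d)\<^sup>2 * (sinh (2 * a) + sinh (2 * b))
      = 2 * ((g d)\<^sup>2 * S * C + (g d * sinh b) * (g d * cosh b))"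
    unfolding sinh_double C_def S_def by (simp add: algebra_simps power2_eq_square)
  also have "\<dots> = 2 * P d * (Q d * (C\<^sup>2 + S\<^sup>2) - 2 * P d * S * C)"
    unfolding b using Q_sq_minus_P_sq[of d] by algebra
  also have "\<dots> = - 2 * P d * (?n * (e1\<^sup>2 + e2\<^sup>2)) - 2 * P d * g d * (k1 * k2 - s1 * s2)"
    unfolding grad' by algebra
  also have "\<dots> = (g d)\<^sup>2 * (- 2 * (\<sigma>2 - \<sigma>1) * ?n * sin d / (g d)\<^sup>2 * (e1\<^sup>2 + e2\<^sup>2)
      + - 2 * (\<sigma>2 - \<sigma>1) / g d * ((k1 * k2 - s1 * s2) * sin d))"
    using g unfolding P_def by (simp add: field_simps power2_eq_square)
  finally show ?thesis using g unfolding d_def[symmetric] sin2 by simp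
qed

text \<open>Eliminating the derivatives of the unknown from the two type-1 systems leaves two equations,
  linear in the \<open>sinh\<close> and \<open>cosh\<close> of half its value, with determinant proportional to
  \<open>sin (A + B) g\<close>. So two different half-values \<open>b\<close> and \<open>c\<close> can only occur where
  \<open>sin (A + B) = 0\<close>. If \<open>cos (A + B) = -1\<close> they may indeed occur. If \<open>cos (A + B) = 1\<close> they cannot:
  the points \<open>(sinh, cosh)\<close> lie on the upper branch of a hyperbola, whose secants have slope
  \<open>tanh p\<close> of absolute value less than 1, with \<open>p = (b + c) / 2\<close>, whereas the kernel of the linear
  system has a slope greater than 1 in absolute value, because \<open>g > 0\<close> and \<open>c1 \<noteq> c2\<close>.\<close>

lemma superposed_unique:
  assumes g: "g (B - A) > 0" and nd: "cos (A + B) \<noteq> - 1" and neq: "c1 \<noteq> c2"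
    and 1: "2 / c2 * (sinh b * cos A + \<sigma>2 * cosh b * sin A) - 2 / c1 * (sinh b * cos B + \<sigma>1 * cosh b * sin B)
      = 2 / c2 * (sinh c * cos A + \<sigma>2 * cosh c * sin A) - 2 / c1 * (sinh c * cos B + \<sigma>1 * cosh c * sin B)"
    and 2: "2 / c2 * (\<sigma>2 * sinh b * cos A - cosh b * sin A) - 2 / c1 * (\<sigma>1 * sinh b * cos B - cosh b * sin B)
      = 2 / c2 * (\<sigma>2 * sinh c * cos A - cosh c * sin A) - 2 / c1 * (\<sigma>1 * sinh c * cos B - cosh c * sin B)"
  shows "b = c"
proof (rule ccontr)
  assume "b \<noteq> c"
  define p q where "p = (b + c) / 2" and "q = (b - c) / 2"
  have bc: "b = p + q" "c = p - q" by (simp_all add: p_def q_def field_simps)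
  have q: "sinh q \<noteq> 0" using \<open>b \<noteq> c\<close> by (simp add: q_def)
  define X Y where "X = cosh p" and "Y = sinh p"
  have XY: "X\<^sup>2 = 1 + Y\<^sup>2" by (simp add: X_def Y_def cosh_square_eq)
  have "sinh q * (X * (c1 * cos A - c2 * cos B) + Y * (c1 * \<sigma>2 * sin A - c2 * \<sigma>1 * sin B)) = 0"
    using 1 c1_pos c2_pos unfolding bc X_def Y_def
    by (simp add: sinh_add cosh_add sinh_diff cosh_diff field_simps)
  then have 1: "X * (c1 * cos A - c2 * cos B) + Y * (c1 * \<sigma>2 * sin A - c2 * \<sigma>1 * sin B) = 0"
    using q by simp
  have "sinh q * (X * (c1 * \<sigma>2 * cos A - c2 * \<sigma>1 * cos B) - Y * (c1 * sin A - c2 * sin B)) = 0"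
    using 2 c1_pos c2_pos unfolding bc X_def Y_def
    by (simp add: sinh_add cosh_add sinh_diff cosh_diff field_simps)
  then have 2: "X * (c1 * \<sigma>2 * cos A - c2 * \<sigma>1 * cos B) - Y * (c1 * sin A - c2 * sin B) = 0"
    using q by simp
  \<comment> \<open>A nonzero vector \<open>(X, Y)\<close> in the kernel makes the determinant vanish.\<close>
  have "X * (c1 * c2 * (sin (A + B) * g (B - A))) = 0"
  proof -
    have "sin (A + B) * g (B - A) = c1 * c2 * (sin A * cos A + sin B * cos B)
        - (1 + \<sigma>1 * \<sigma>2) * (sin A * cos B + cos A * sin B)"
      unfolding g_def sin_add cos_diff
      using sin_cos_squared_add[of A] sin_cos_squared_add[of B] by algebra
    then show ?thesis using 1 2 c1_sq c2_sq by algebra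
  qed
  then have "sin (A + B) = 0" using c1_pos c2_pos g by (simp add: X_def)
  then have cos1: "cos (A + B) = 1"
    using nd sin_cos_squared_add[of "A + B"] by (simp add: power2_eq_1_iff)
  have B: "cos B = cos A" "sin B = - sin A"
    using cos_diff[of "A + B" A] sin_diff[of "A + B" A] cos1 \<open>sin (A + B) = 0\<close> by simp_all
  \<comment> \<open>In terms of \<open>m\<close> and \<open>n\<close>, both squared coefficients of the remaining equation share the
    positive factor \<open>n + m - 2\<close>; what is left, \<open>n - m\<close> against \<open>n + m\<close>, is compared by
    \<open>g = n cos (2 A) - m > 0\<close>.\<close>
  define m n where "m = 1 + \<sigma>1 * \<sigma>2" and "n = c1 * c2"
  have "(c1 - c2)\<^sup>2 = (n + m - 2) * (n - m)"
    using c1_sq c2_sq unfolding m_def n_def by algebra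
  have "\<bar>m\<bar> \<le> n" using abs_le_c1_c2 by (simp add: n_def m_def)
  then have "n \<ge> m" "n + m \<ge> 0" by linarith+
  have pos: "0 < n + m - 2"
  proof -
    have "0 < (n + m - 2) * (n - m)" using neq by (simp flip: \<open>(c1 - c2)\<^sup>2 = _\<close>)
    then show ?thesis using \<open>n \<ge> m\<close> by (simp add: zero_less_mult_iff)
  qed
  have sum: "(c1 * \<sigma>2 + c2 * \<sigma>1)\<^sup>2 = (n + m - 2) * (n + m)"
    using c1_sq c2_sq unfolding m_def n_def by algebra
  have "0 < n * ((cos A)\<^sup>2 - (sin A)\<^sup>2) - m"
    using g by (simp add: g_def cos_diff B power2_eq_square n_def m_def)
  then have slope: "(n + m) * (sin A)\<^sup>2 < (n - m) * (cos A)\<^sup>2"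
    using sin_cos_squared_add[of A] by (simp add: cos_squared_eq algebra_simps)
  have "X * cos A * (c1 - c2) = - (Y * sin A * (c1 * \<sigma>2 + c2 * \<sigma>1))"
    using 1 unfolding B by (simp add: algebra_simps)
  then have "(X * cos A * (c1 - c2))\<^sup>2 = (Y * sin A * (c1 * \<sigma>2 + c2 * \<sigma>1))\<^sup>2" by simp
  then have "(n + m - 2) * (X\<^sup>2 * ((n - m) * (cos A)\<^sup>2)) = (n + m - 2) * (Y\<^sup>2 * ((n + m) * (sin A)\<^sup>2))"
    unfolding power_mult_distrib sum \<open>(c1 - c2)\<^sup>2 = _\<close> by (simp add: ac_simps)
  then have eq: "X\<^sup>2 * ((n - m) * (cos A)\<^sup>2) = Y\<^sup>2 * ((n + m) * (sin A)\<^sup>2)" using pos by simp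
  have "X\<^sup>2 * ((n - m) * (cos A)\<^sup>2) \<le> Y\<^sup>2 * ((n - m) * (cos A)\<^sup>2)"
    unfolding eq using slope by (intro mult_left_mono) auto
  then have "(n - m) * (cos A)\<^sup>2 \<le> 0" unfolding XY by (simp add: algebra_simps)
  moreover have "0 \<le> (n + m) * (sin A)\<^sup>2" 
    using \<open>n + m \<ge> 0\<close> by simp
  ultimately show False using slope by linarith
qed

end

section \<open>Superposition of Baecklund transforms\<close>

text \<open>For a given \<open>\<alpha>'\<close> the type-1 system prescribes the whole gradient of its solution, so a solution
  is determined by one value. To make the difference of two solutions obey a linear equation, it is
  measured by \<open>sinh ((\<beta> - \<gamma>) / 4)\<close>: with \<open>p\<close> the mean and \<open>q\<close> half the difference of the half-values,
  \<open>sinh (p + q) - sinh (p - q) = 2 cosh p sinh q\<close> and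
  \<open>cosh (p + q) - cosh (p - q) = 2 sinh p sinh q\<close> both contain the factor \<open>sinh q\<close>.\<close>

lemma baecklund1_unique_continuation:
  assumes "open U" "connected U"
    and b: "C1_on U \<beta>" and c: "C1_on U \<gamma>" and \<alpha>': "continuous_on U \<alpha>'"
    and B: "baecklund1_on U \<tau> \<phi> \<alpha>' \<beta>" "baecklund1_on U \<tau> \<phi> \<alpha>' \<gamma>"
    and "x0 \<in> U" "\<gamma> x0 = \<beta> x0" "x \<in> U"
  shows "\<gamma> x = \<beta> x"
proof -
  define p where "p x = (\<beta> x / 2 + \<gamma> x / 2) / 2" for x
  define q where "q x = 1 / 4 * \<beta> x + - 1 / 4 * \<gamma> x" for x
  have half: "\<beta> x / 2 = p x + q x" "\<gamma> x / 2 = p x - q x" for x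
    by (simp_all add: p_def q_def field_simps)
  define k1 where "k1 x = cosh (q x) / cosh \<phi> * (cosh (p x) * cos (\<alpha>' x / 2)
    + \<tau> * sinh \<phi> * sinh (p x) * sin (\<alpha>' x / 2))" for x
  define k2 where "k2 x = cosh (q x) / cosh \<phi> * (\<tau> * sinh \<phi> * cosh (p x) * cos (\<alpha>' x / 2)
    - sinh (p x) * sin (\<alpha>' x / 2))" for x
  note q = C1_on_linear_combination[OF b c, where a = "1 / 4" and b = "- 1 / 4", folded q_def]
  have sinh_q: "(sinh has_field_derivative cosh (q x)) (at (q x))" for x
    by (auto intro!: derivative_eq_intros)
  have cont: "continuous_on U q" "continuous_on U p"
    unfolding p_def q_def using C1_on_continuous_on[OF b] C1_on_continuous_on[OF c]
    by (auto intro!: continuous_intros)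
  note z = C1_on_compose[OF q(1) sinh_q continuous_on_cosh[OF cont(1)]]
  have "sinh (q x) = 0"
  proof (rule zero_on_connected_of_log_gradient[OF assms(1,2) z(1), of k1 k2])
    show "continuous_on U k1" "continuous_on U k2"
      unfolding k1_def k2_def using cont \<alpha>' by (auto intro!: continuous_intros)
    fix x assume x: "x \<in> U"
    have b1: "pd1 \<beta> x - pd2 \<alpha>' x = 2 / cosh \<phi> * sinh (p x + q x) * cos (\<alpha>' x / 2)
        + 2 * \<tau> * sinh \<phi> / cosh \<phi> * cosh (p x + q x) * sin (\<alpha>' x / 2)"
      and b2: "pd2 \<beta> x + pd1 \<alpha>' x = - (2 / cosh \<phi>) * cosh (p x + q x) * sin (\<alpha>' x / 2)
        + 2 * \<tau> * sinh \<phi> / cosh \<phi> * sinh (p x + q x) * cos (\<alpha>' x / 2)"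
      using B(1) x unfolding baecklund1_on_def half by blast+
    have c1: "pd1 \<gamma> x - pd2 \<alpha>' x = 2 / cosh \<phi> * sinh (p x - q x) * cos (\<alpha>' x / 2)
        + 2 * \<tau> * sinh \<phi> / cosh \<phi> * cosh (p x - q x) * sin (\<alpha>' x / 2)"
      and c2: "pd2 \<gamma> x + pd1 \<alpha>' x = - (2 / cosh \<phi>) * cosh (p x - q x) * sin (\<alpha>' x / 2)
        + 2 * \<tau> * sinh \<phi> / cosh \<phi> * sinh (p x - q x) * cos (\<alpha>' x / 2)"
      using B(2) x unfolding baecklund1_on_def half by blast+
    have "pd1 q x = ((pd1 \<beta> x - pd2 \<alpha>' x) - (pd1 \<gamma> x - pd2 \<alpha>' x)) / 4"
      by (simp add: q(2)[OF x])
    also have "\<dots> = (cosh (p x) * cos (\<alpha>' x / 2) + \<tau> * sinh \<phi> * sinh (p x) * sin (\<alpha>' x / 2))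
        / cosh \<phi> * sinh (q x)"
      unfolding b1 c1 sinh_add sinh_diff cosh_add cosh_diff by (simp add: field_simps)
    finally show "pd1 (\<lambda>x. sinh (q x)) x = k1 x * sinh (q x)"
      using z(2)[OF x] by (simp add: k1_def)
    have "pd2 q x = ((pd2 \<beta> x + pd1 \<alpha>' x) - (pd2 \<gamma> x + pd1 \<alpha>' x)) / 4"
      by (simp add: q(3)[OF x])
    also have "\<dots> = (\<tau> * sinh \<phi> * cosh (p x) * cos (\<alpha>' x / 2) - sinh (p x) * sin (\<alpha>' x / 2))
        / cosh \<phi> * sinh (q x)"
      unfolding b2 c2 sinh_add sinh_diff cosh_add cosh_diff by (simp add: field_simps)
    finally show "pd2 (\<lambda>x. sinh (q x)) x = k2 x * sinh (q x)"
      using z(3)[OF x] by (simp add: k2_def)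
  next
    show "x0 \<in> U" "x \<in> U" by fact+
    show "sinh (q x0) = 0" using \<open>\<gamma> x0 = \<beta> x0\<close> by (simp add: q_def)
  qed
  then show ?thesis by (simp add: q_def)
qed

theorem theorem3p2:
  fixes U :: "(real \<times> real) set"
    and \<tau> \<phi>\<^sub>1 \<phi>\<^sub>2 :: real
    and \<alpha> \<alpha>' \<alpha>'' :: "real \<times> real \<Rightarrow> real"
  assumes "open U" and "connected U"
    and "\<tau> \<in> {1, -1}"
    and "0 \<le> \<phi>\<^sub>1" and "0 \<le> \<phi>\<^sub>2"
    and "elliptic_sinh_gordon_on U \<alpha>"
    and "elliptic_sine_gordon_on U \<alpha>'" and "elliptic_sine_gordon_on U \<alpha>''"
    and "baecklund0_on U \<tau> \<phi>\<^sub>1 \<alpha> \<alpha>'" and "baecklund0_on U \<tau> \<phi>\<^sub>2 \<alpha> \<alpha>''"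
    and "\<phi>\<^sub>1 \<noteq> \<phi>\<^sub>2"
    and "\<forall>x\<in>U. superposition_regular \<phi>\<^sub>1 \<phi>\<^sub>2 (\<alpha>' x) (\<alpha>'' x)"
  shows "\<exists>\<beta>. associated_to_both_on U \<tau> \<phi>\<^sub>1 \<phi>\<^sub>2 \<alpha>' \<alpha>'' \<beta> \<and>
    ((\<exists>x\<in>U. \<not> superposition_degenerate (\<alpha>' x) (\<alpha>'' x)) \<longrightarrow>
      (\<forall>\<gamma>. associated_to_both_on U \<tau> \<phi>\<^sub>1 \<phi>\<^sub>2 \<alpha>' \<alpha>'' \<gamma> \<longrightarrow> (\<forall>x\<in>U. \<gamma> x = \<beta> x))) \<and>
    (\<forall>x\<in>U.
      let P = superposition_P \<tau> \<phi>\<^sub>1 \<phi>\<^sub>2 (\<alpha>' x) (\<alpha>'' x);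
          Q = superposition_Q \<phi>\<^sub>1 \<phi>\<^sub>2 (\<alpha>' x) (\<alpha>'' x)
      in tanh (\<beta> x / 2) = (P - Q * tanh (\<alpha> x / 2)) / (Q - P * tanh (\<alpha> x / 2)))"
proof -
  have \<tau>: "\<tau>\<^sup>2 = 1" using assms(3) by auto
  define \<sigma>1 \<sigma>2 where "\<sigma>1 = \<tau> * sinh \<phi>\<^sub>1" and "\<sigma>2 = \<tau> * sinh \<phi>\<^sub>2"
  define c1 c2 where "c1 = cosh \<phi>\<^sub>1" and "c2 = cosh \<phi>\<^sub>2"
  have sq: "c1\<^sup>2 = 1 + \<sigma>1\<^sup>2" "c2\<^sup>2 = 1 + \<sigma>2\<^sup>2"
    by (simp_all add: \<sigma>1_def \<sigma>2_def c1_def c2_def power_mult_distrib \<tau> cosh_square_eq)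
  have \<sigma>\<sigma>: "\<sigma>1 * \<sigma>2 = sinh \<phi>\<^sub>1 * sinh \<phi>\<^sub>2"
    using \<tau> by (simp add: \<sigma>1_def \<sigma>2_def power2_eq_square)
  have pos: "c1 > 0" "c2 > 0" by (simp_all add: c1_def c2_def)
  have neq: "c1 \<noteq> c2"
    using assms(4,5,11) by (auto simp: c1_def c2_def)
  interpret S: superposition c1 \<sigma>1 c2 \<sigma>2 using pos sq by unfold_locales
  \<comment> \<open>Exchanging the parameters together with \<open>\<alpha>'\<close> and \<open>\<alpha>''\<close> reverses \<open>d\<close> and leaves the superposed
    function unchanged, so the computation for \<open>\<alpha>'\<close> also gives the system from \<open>\<alpha>''\<close>.\<close>
  interpret T: superposition c2 \<sigma>2 c1 \<sigma>1 using pos sq by unfold_locales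
  have swap: "T.g (- d) = S.g d" "T.shift (- d) = S.shift d" for d
    by (simp_all add: T.g_def S.g_def T.shift_def S.shift_def T.P_def S.P_def T.Q_def S.Q_def
        mult.commute algebra_simps)
  define A B a where "A x = \<alpha>' x / 2" and "B x = \<alpha>'' x / 2" and "a x = \<alpha> x / 2" for x
  \<comment> \<open>\<open>D\<close> and \<open>\<beta>\<close> are written as linear combinations so that the differentiation rules apply
    literally.\<close>
  define D where "D x = 1 / 2 * \<alpha>'' x + - 1 / 2 * \<alpha>' x" for x
  have D: "D x = B x - A x" "(\<alpha>'' x - \<alpha>' x) / 2 = D x" for x
    by (simp_all add: D_def A_def B_def field_simps)
  have g: "S.g (D x) > 0" if "x \<in> U" for x
    using assms(12) that
    unfolding superposition_regular_def D(2) c1_def[symmetric] c2_def[symmetric] \<sigma>\<sigma>[symmetric]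
    by (simp add: S.g_def)
  have PQ: "superposition_P \<tau> \<phi>\<^sub>1 \<phi>\<^sub>2 (\<alpha>' x) (\<alpha>'' x) = S.P (D x)"
    "superposition_Q \<phi>\<^sub>1 \<phi>\<^sub>2 (\<alpha>' x) (\<alpha>'' x) = S.Q (D x)" for x
    unfolding superposition_P_def superposition_Q_def S.P_def S.Q_def D(2) \<sigma>\<sigma>
    by (simp_all add: \<sigma>1_def \<sigma>2_def c1_def c2_def algebra_simps)
  define \<beta> where "\<beta> x = 1 * S.shift (D x) + - 1 * \<alpha> x" for x
  have b: "\<beta> x / 2 = S.shift (D x) / 2 - a x" for x by (simp add: \<beta>_def a_def field_simps)

  have C2: "C2_on U \<alpha>" "C2_on U \<alpha>'" "C2_on U \<alpha>''"
    using assms(6-8) by (simp_all add: elliptic_sinh_gordon_on_def elliptic_sine_gordon_on_def)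
  have C1: "C1_on U \<alpha>" "C1_on U \<alpha>'" "C1_on U \<alpha>''" using C2 by (simp_all add: C2_on_def)
  note D_C2 = C2_on_linear_combination[OF assms(1) C2(3,2), where a = "1 / 2" and b = "- 1 / 2", folded D_def]
  note D_C1 = C1_on_linear_combination[OF C1(3,2), where a = "1 / 2" and b = "- 1 / 2", folded D_def]
  have "continuous_on U D" using D_C1(1) by (rule C1_on_continuous_on)
  then have cont: "continuous_on U (\<lambda>x. - 2 * (\<sigma>2 - \<sigma>1) * (c1 * c2) * sin (D x) / (S.g (D x))\<^sup>2)"
    using g unfolding S.g_def by (intro continuous_intros) force+
  have cont': "continuous_on U (\<lambda>x. - 2 * (\<sigma>2 - \<sigma>1) / S.g (D x))"
    using g \<open>continuous_on U D\<close> unfolding S.g_def by (intro continuous_intros) force+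
  have shift_C1: "C1_on U (\<lambda>x. S.shift (D x))"
    "\<And>x. x \<in> U \<Longrightarrow> pd1 (\<lambda>x. S.shift (D x)) x = - 2 * (\<sigma>2 - \<sigma>1) / S.g (D x) * pd1 D x"
    "\<And>x. x \<in> U \<Longrightarrow> pd2 (\<lambda>x. S.shift (D x)) x = - 2 * (\<sigma>2 - \<sigma>1) / S.g (D x) * pd2 D x"
    using C1_on_compose[OF D_C1(1) S.shift_has_field_derivative[OF g] cont'] by simp_all
  have shift_C2: "C2_on U (\<lambda>x. S.shift (D x))"
    "\<And>x. x \<in> U \<Longrightarrow> pd1 (pd1 (\<lambda>x. S.shift (D x))) x + pd2 (pd2 (\<lambda>x. S.shift (D x))) x
      = - 2 * (\<sigma>2 - \<sigma>1) * (c1 * c2) * sin (D x) / (S.g (D x))\<^sup>2 * ((pd1 D x)\<^sup>2 + (pd2 D x)\<^sup>2)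
        + - 2 * (\<sigma>2 - \<sigma>1) / S.g (D x) * (pd1 (pd1 D) x + pd2 (pd2 D) x)"
    using C2_on_compose[OF assms(1) D_C2(1) S.shift_has_field_derivative[OF g]
      S.shift_derivative_has_field_derivative[OF g] cont] by simp_all
  note \<beta>_C1 = C1_on_linear_combination[OF shift_C1(1) C1(1), where a = 1 and b = "- 1", folded \<beta>_def]
  note \<beta>_C2 = C2_on_linear_combination[OF assms(1) shift_C2(1) C2(1), where a = 1 and b = "- 1", folded \<beta>_def]

  have \<alpha>': "pd1 \<alpha>' x = pd2 \<alpha> x + 2 / c1 * (sin (A x) * cosh (a x) + \<sigma>1 * cos (A x) * sinh (a x))"
    "pd2 \<alpha>' x = - pd1 \<alpha> x + 2 / c1 * (\<sigma>1 * sin (A x) * cosh (a x) - cos (A x) * sinh (a x))"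
    if "x \<in> U" for x
    using assms(9) that unfolding baecklund0_on_def A_def a_def \<sigma>1_def c1_def
    by (auto simp: algebra_simps)
  have \<alpha>'': "pd1 \<alpha>'' x = pd2 \<alpha> x + 2 / c2 * (sin (B x) * cosh (a x) + \<sigma>2 * cos (B x) * sinh (a x))"
    "pd2 \<alpha>'' x = - pd1 \<alpha> x + 2 / c2 * (\<sigma>2 * sin (B x) * cosh (a x) - cos (B x) * sinh (a x))"
    if "x \<in> U" for x
    using assms(10) that unfolding baecklund0_on_def B_def a_def \<sigma>2_def c2_def
    by (auto simp: algebra_simps)

  have dD: "pd1 D x = (sin (B x) * cosh (a x) + \<sigma>2 * cos (B x) * sinh (a x)) / c2
      - (sin (A x) * cosh (a x) + \<sigma>1 * cos (A x) * sinh (a x)) / c1"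
    "pd2 D x = (\<sigma>2 * sin (B x) * cosh (a x) - cos (B x) * sinh (a x)) / c2
      - (\<sigma>1 * sin (A x) * cosh (a x) - cos (A x) * sinh (a x)) / c1" if "x \<in> U" for x
    unfolding D_C1(2,3)[OF that] \<alpha>'[OF that] \<alpha>''[OF that]
    by (simp_all add: algebra_simps add_divide_distrib diff_divide_distrib)
  have d\<beta>: "pd1 \<beta> x = - 2 * (\<sigma>2 - \<sigma>1) / S.g (B x - A x) * pd1 D x - pd1 \<alpha> x"
    "pd2 \<beta> x = - 2 * (\<sigma>2 - \<sigma>1) / S.g (B x - A x) * pd2 D x - pd2 \<alpha> x" if "x \<in> U" for x
    using \<beta>_C1(2,3)[OF that] shift_C1(2,3)[OF that] by (simp_all add: D)
  have gBA: "S.g (B x - A x) > 0" "T.g (A x - B x) > 0" if "x \<in> U" for x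
    using g[OF that] swap(1)[of "B x - A x"] by (simp_all add: D)

  have \<beta>': "pd1 \<beta> x - pd2 \<alpha>' x = 2 / c2 * (sinh (\<beta> x / 2) * cos (A x) + \<sigma>2 * cosh (\<beta> x / 2) * sin (A x))"
    "pd2 \<beta> x + pd1 \<alpha>' x = 2 / c2 * (\<sigma>2 * sinh (\<beta> x / 2) * cos (A x) - cosh (\<beta> x / 2) * sin (A x))"
    if "x \<in> U" for x
    unfolding b D(1) S.superposed_gradient[OF gBA(1)[OF that], of "a x", symmetric]
    by (simp_all add: d\<beta>[OF that] dD[OF that] \<alpha>'[OF that])
  have \<beta>'': "pd1 \<beta> x - pd2 \<alpha>'' x = 2 / c1 * (sinh (\<beta> x / 2) * cos (B x) + \<sigma>1 * cosh (\<beta> x / 2) * sin (B x))"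
    "pd2 \<beta> x + pd1 \<alpha>'' x = 2 / c1 * (\<sigma>1 * sinh (\<beta> x / 2) * cos (B x) - cosh (\<beta> x / 2) * sin (B x))"
    if "x \<in> U" for x
  proof -
    have S_T: "S.g (B x - A x) = T.g (A x - B x)" "S.shift (B x - A x) = T.shift (A x - B x)"
      using swap[of "B x - A x"] by simp_all
    have flip: "- 2 * (\<sigma>2 - \<sigma>1) / u * v = - 2 * (\<sigma>1 - \<sigma>2) / u * (- v)" for u v
      by (simp add: divide_inverse algebra_simps)
    have "pd1 \<beta> x = - 2 * (\<sigma>1 - \<sigma>2) / T.g (A x - B x)
          * ((sin (A x) * cosh (a x) + \<sigma>1 * cos (A x) * sinh (a x)) / c1
            - (sin (B x) * cosh (a x) + \<sigma>2 * cos (B x) * sinh (a x)) / c2) - pd1 \<alpha> x"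
      "pd2 \<beta> x = - 2 * (\<sigma>1 - \<sigma>2) / T.g (A x - B x)
          * ((\<sigma>1 * sin (A x) * cosh (a x) - cos (A x) * sinh (a x)) / c1
            - (\<sigma>2 * sin (B x) * cosh (a x) - cos (B x) * sinh (a x)) / c2) - pd2 \<alpha> x"
      unfolding d\<beta>[OF that] S_T dD[OF that] flip by simp_all
    then show "pd1 \<beta> x - pd2 \<alpha>'' x = 2 / c1 * (sinh (\<beta> x / 2) * cos (B x) + \<sigma>1 * cosh (\<beta> x / 2) * sin (B x))"
      "pd2 \<beta> x + pd1 \<alpha>'' x = 2 / c1 * (\<sigma>1 * sinh (\<beta> x / 2) * cos (B x) - cosh (\<beta> x / 2) * sin (B x))"
      unfolding b D(1) S_T T.superposed_gradient[OF gBA(2)[OF that], of "a x", symmetric]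
      by (simp_all add: \<alpha>''[OF that])
  qed

  have "elliptic_sinh_gordon_on U \<beta>"
    unfolding elliptic_sinh_gordon_on_def
  proof (intro conjI ballI)
    show "C2_on U \<beta>" by (rule \<beta>_C2(1))
    fix x assume x: "x \<in> U"
    have eqs: "pd1 (pd1 \<alpha>) x + pd2 (pd2 \<alpha>) x = sinh (2 * a x)"
      "pd1 (pd1 \<alpha>') x + pd2 (pd2 \<alpha>') x = sin (2 * A x)"
      "pd1 (pd1 \<alpha>'') x + pd2 (pd2 \<alpha>'') x = sin (2 * B x)"
      using assms(6-8) x
      by (simp_all add: elliptic_sinh_gordon_on_def elliptic_sine_gordon_on_def a_def A_def B_def)
    have "pd1 (pd1 \<beta>) x + pd2 (pd2 \<beta>) x
      = - 2 * (\<sigma>2 - \<sigma>1) * (c1 * c2) * sin (B x - A x) / (S.g (B x - A x))\<^sup>2 * ((pd1 D x)\<^sup>2 + (pd2 D x)\<^sup>2)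
        + - 2 * (\<sigma>2 - \<sigma>1) / S.g (B x - A x) * ((sin (2 * B x) - sin (2 * A x)) / 2) - sinh (2 * a x)"
      unfolding \<beta>_C2(2)[OF x] shift_C2(2)[OF x] D_C2(2)[OF x] eqs D(1)[of x] by (simp add: diff_divide_distrib)
    also have "\<dots> = sinh (2 * (\<beta> x / 2))"
      unfolding dD[OF x] b D(1) S.superposed_laplacian[OF gBA(1)[OF x], of "a x"] by simp
    finally show "pd1 (pd1 \<beta>) x + pd2 (pd2 \<beta>) x = sinh (\<beta> x)" by simp
  qed
  moreover have B1: "baecklund1_on U \<tau> \<phi>\<^sub>2 \<alpha>' \<beta>"
    unfolding baecklund1_on_def
    using \<beta>' by (simp add: A_def c2_def \<sigma>2_def algebra_simps)
  moreover have "baecklund1_on U \<tau> \<phi>\<^sub>1 \<alpha>'' \<beta>"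
    unfolding baecklund1_on_def
    using \<beta>'' by (simp add: B_def c1_def \<sigma>1_def algebra_simps)
  ultimately have assoc: "associated_to_both_on U \<tau> \<phi>\<^sub>1 \<phi>\<^sub>2 \<alpha>' \<alpha>'' \<beta>"
    by (simp add: associated_to_both_on_def)
  have unique: "\<gamma> x = \<beta> x"
    if x0: "x0 \<in> U" "\<not> superposition_degenerate (\<alpha>' x0) (\<alpha>'' x0)"
      and \<gamma>: "associated_to_both_on U \<tau> \<phi>\<^sub>1 \<phi>\<^sub>2 \<alpha>' \<alpha>'' \<gamma>" and x: "x \<in> U" for x0 \<gamma> x
  proof -
    have \<gamma>_C1: "C1_on U \<gamma>" and \<gamma>1: "baecklund1_on U \<tau> \<phi>\<^sub>2 \<alpha>' \<gamma>" and \<gamma>2: "baecklund1_on U \<tau> \<phi>\<^sub>1 \<alpha>'' \<gamma>"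
      using \<gamma> by (auto simp: associated_to_both_on_def elliptic_sinh_gordon_on_def C2_on_def)
    have \<gamma>': "pd1 \<gamma> x0 - pd2 \<alpha>' x0 = 2 / c2 * (sinh (\<gamma> x0 / 2) * cos (A x0) + \<sigma>2 * cosh (\<gamma> x0 / 2) * sin (A x0))"
      "pd2 \<gamma> x0 + pd1 \<alpha>' x0 = 2 / c2 * (\<sigma>2 * sinh (\<gamma> x0 / 2) * cos (A x0) - cosh (\<gamma> x0 / 2) * sin (A x0))"
      using \<gamma>1 x0(1) unfolding baecklund1_on_def A_def c2_def \<sigma>2_def by (auto simp: algebra_simps)
    have \<gamma>'': "pd1 \<gamma> x0 - pd2 \<alpha>'' x0 = 2 / c1 * (sinh (\<gamma> x0 / 2) * cos (B x0) + \<sigma>1 * cosh (\<gamma> x0 / 2) * sin (B x0))"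
      "pd2 \<gamma> x0 + pd1 \<alpha>'' x0 = 2 / c1 * (\<sigma>1 * sinh (\<gamma> x0 / 2) * cos (B x0) - cosh (\<gamma> x0 / 2) * sin (B x0))"
      using \<gamma>2 x0(1) unfolding baecklund1_on_def B_def c1_def \<sigma>1_def by (auto simp: algebra_simps)
    have nd: "cos (A x0 + B x0) \<noteq> - 1"
      using x0(2) by (simp add: superposition_degenerate_def A_def B_def add_divide_distrib)
    have "\<gamma> x0 / 2 = \<beta> x0 / 2"
      by (rule S.superposed_unique[OF gBA(1)[OF x0(1)] nd neq])
        (simp_all only: \<gamma>'[symmetric] \<gamma>''[symmetric] \<beta>'[OF x0(1), symmetric] \<beta>''[OF x0(1), symmetric])
    then have "\<gamma> x0 = \<beta> x0" by simp
    with baecklund1_unique_continuation[OF assms(1,2) \<beta>_C1(1) \<gamma>_C1 C1_on_continuous_on[OF C1(2)] B1 \<gamma>1 x0(1) _ x]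
    show ?thesis by simp
  qed
  have formula: "tanh (\<beta> x / 2)
      = (S.P (D x) - S.Q (D x) * tanh (\<alpha> x / 2)) / (S.Q (D x) - S.P (D x) * tanh (\<alpha> x / 2))"
    if "x \<in> U" for x
    unfolding b S.tanh_superposed[OF g[OF that]] by (simp add: a_def)
  show ?thesis
    unfolding PQ Let_def using assoc unique formula by blast
qed

end
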